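(* Let $f:[0,1]\to[0,1]$ be a continuous map. Then $$\omega(f)=\bigcap_{n\ge0}f^n\Omega(f).$$
   Context: For $x\in[0,1]$, $\omega(x)$ is the set of limit points of the forward orbit $\{f^ix:i\ge0\}$, and $\omega(f)=\bigcup_{x\in[0,1]}\omega(x)$. $\Omega(f)$ is the set of non-wandering points: $x\in\Omega(f)$ if for any open $U\ni x$ there is $n>0$ with $f^nU\cap U\ne\emptyset$. *)

theory Defs
  imports "HOL-Analysis.Analysis"
begin

text \<open>
  A self-map of \<open>[0,1]\<close> is a function on the reals preserving \<open>{0..1}\<close>. The sets below
  depend only on its restriction to \<open>{0..1}\<close>, as long as the base point lies in \<open>{0..1}\<close>.
\<close>

(* Limit points are those of the orbit as a sequence, not the accumulation points (islimpt) of its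
   range: a periodic orbit is its own limit set. *)
definition omega_limit :: "(real \<Rightarrow> real) \<Rightarrow> real \<Rightarrow> real set" where
  "omega_limit f x = {y. \<exists>r :: nat \<Rightarrow> nat. strict_mono r \<and> (\<lambda>i. (f ^^ r i) x) \<longlonglongrightarrow> y}"

definition omega_set :: "(real \<Rightarrow> real) \<Rightarrow> real set" where
  "omega_set f = (\<Union>x\<in>{0..1}. omega_limit f x)"

(* Neighbourhoods are open in the subspace [0,1], not in the real line. *)
definition nonwandering_set :: "(real \<Rightarrow> real) \<Rightarrow> real set" where
  "nonwandering_set f = {x \<in> {0..1}. \<forall>U. openin (top_of_set {0..1}) U \<and> x \<in> U \<longrightarrow>
     (\<exists>n>0. (f ^^ n) ` U \<inter> U \<noteq> {})}"

end

theory Submission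
  imports Defs
begin

text \<open>
  Limit points are non-wandering and every limit set is mapped onto itself, which gives one
  inclusion. For the other, let \<open>y\<close> be outside its own limit set and choose non-wandering \<open>q n\<close> with
  \<open>(f ^^ n) (q n) = y\<close>; they are distinct because \<open>y\<close> is not periodic. On one side of \<open>y\<close>, the
  segments \<open>J\<close> ending in \<open>y\<close> have orbits that come close to infinitely many \<open>q n\<close>. Since the orbit
  of \<open>y\<close> stays away from \<open>y\<close>, infinitely many images of \<open>J\<close> are large and share a point, so the orbit
  of \<open>J\<close> is, up to finitely many images, a union of finitely many connected sets. One of them has
  infinitely many \<open>q n\<close> in its closure, hence one in its interior. Therefore some image of \<open>J\<close>
  contains \<open>q n\<close> together with nearby points that \<open>f ^^ n\<close> sends to the chosen side of \<open>y\<close>, and a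
  later image of \<open>J\<close> contains a segment ending in \<open>y\<close> on the same side. Iterating produces a point
  whose limit set contains \<open>y\<close>.
\<close>

section \<open>Limit points of orbits, chains of connected sets and real segments\<close>

lemma LIMSEQ_if_dist_le_inverse:
  fixes X :: "nat \<Rightarrow> 'a::metric_space"
  assumes "\<And>n. dist (X n) y \<le> 1 / real (Suc n)"
  shows "X \<longlonglongrightarrow> y"
proof (rule tendsto_dist_iff[THEN iffD2], rule tendsto_sandwich[OF _ _ tendsto_const])
  show "(\<lambda>n. 1 / real (Suc n)) \<longlonglongrightarrow> 0"
    using LIMSEQ_inverse_real_of_nat by (simp add: inverse_eq_divide)
qed (use assms in auto)

text \<open>Its negation is what later arguments use: outside the limit set, there are a radius and
  an index after which the orbit keeps at least that distance.\<close>

lemma omega_limit_iff: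
  "y \<in> omega_limit f x \<longleftrightarrow> (\<forall>e>0. \<forall>N. \<exists>i>N. dist ((f ^^ i) x) y < e)"
proof
  assume "y \<in> omega_limit f x"
  then obtain r :: "nat \<Rightarrow> nat" where r: "strict_mono r" "(\<lambda>i. (f ^^ r i) x) \<longlonglongrightarrow> y"
    by (auto simp: omega_limit_def)
  show "\<forall>e>0. \<forall>N. \<exists>i>N. dist ((f ^^ i) x) y < e"
  proof (intro allI impI)
    fix e :: real and N :: nat
    assume "e > 0"
    then obtain k where k: "\<And>i. i \<ge> k \<Longrightarrow> dist ((f ^^ r i) x) y < e"
      using r(2) by (auto simp: lim_sequentially)
    have "r (max k (Suc N)) > N"
      using seq_suble[OF r(1), of "max k (Suc N)"] by linarith
    then show "\<exists>i>N. dist ((f ^^ i) x) y < e"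
      using k[of "max k (Suc N)"] by auto
  qed
next
  assume R: "\<forall>e>0. \<forall>N. \<exists>i>N. dist ((f ^^ i) x) y < e"
  have "\<exists>r. \<forall>n. dist ((f ^^ r n) x) y < 1 / real (Suc n) \<and> r n < r (Suc n)"
  proof (rule dependent_nat_choice)
    show "\<exists>i. dist ((f ^^ i) x) y < 1 / real (Suc 0)"
      using R[rule_format, of 1 0] by auto
    show "\<exists>j. dist ((f ^^ j) x) y < 1 / real (Suc (Suc n)) \<and> i < j" for i n
      using R[rule_format, of "1 / real (Suc (Suc n))" i] by auto
  qed
  then obtain r :: "nat \<Rightarrow> nat" where
    r: "\<And>n. dist ((f ^^ r n) x) y < 1 / real (Suc n)" "\<And>n. r n < r (Suc n)"
    by blast
  have "(\<lambda>n. (f ^^ r n) x) \<longlonglongrightarrow> y"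
    using r(1) by (intro LIMSEQ_if_dist_le_inverse) (simp add: less_imp_le)
  moreover have "strict_mono r"
    using r(2) by (simp add: strict_mono_Suc_iff)
  ultimately show "y \<in> omega_limit f x"
    by (auto simp: omega_limit_def)
qed

lemma periodic_in_omega_limit:
  assumes "0 < p" and "(f ^^ p) y = y"
  shows "y \<in> omega_limit f y"
  unfolding omega_limit_iff
proof (intro allI impI)
  fix e :: real and N :: nat
  assume "e > 0"
  have "(f ^^ (p * k)) y = y" for k
    by (induction k) (use assms(2) in \<open>auto simp: funpow_add\<close>)
  moreover have "p * Suc N > N"
    using assms(1) by (cases p) auto
  ultimately show "\<exists>i>N. dist ((f ^^ i) y) y < e"
    using \<open>e > 0\<close> by (metis dist_self)
qed

lemma connected_chain:
  fixes C :: "nat \<Rightarrow> 'a::topological_space set"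
  assumes "\<And>j. connected (C j)" and "\<And>j. C j \<inter> C (Suc j) \<noteq> {}"
  shows "connected (\<Union>j\<le>k. C j)"
proof (induction k)
  case 0
  then show ?case using assms(1) by simp
next
  case (Suc k)
  have "C k \<inter> C (Suc k) \<subseteq> (\<Union>j\<le>k. C j) \<inter> C (Suc k)"
    by auto
  then have "(\<Union>j\<le>k. C j) \<inter> C (Suc k) \<noteq> {}"
    using assms(2)[of k] by auto
  then have "connected ((\<Union>j\<le>k. C j) \<union> C (Suc k))"
    using Suc assms(1) by (intro connected_Un)
  then show ?case
    by (simp add: atMost_Suc Un_commute)
qed

lemma closed_segment_subset_connected_real:
  fixes a b :: real
  assumes "connected C" "a \<in> C" "b \<in> C"
  shows "closed_segment a b \<subseteq> C"
  using assms by (intro closed_segment_subset) (auto simp flip: is_interval_connected_1 is_interval_convex_1)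

lemma closed_segment_real_mem_iff:
  fixes y u z :: real
  assumes "0 < s * (z - y)" "0 < s * (u - y)"
  shows "z \<in> closed_segment y u \<longleftrightarrow> \<bar>z - y\<bar> \<le> \<bar>u - y\<bar>"
  using assms by (auto simp: closed_segment_eq_real_ivl zero_less_mult_iff)

section \<open>Iterates of a continuous interval map\<close>

locale interval_map =
  fixes f :: "real \<Rightarrow> real"
  assumes cont: "continuous_on {0..1} f" and maps: "f ` {0..1} \<subseteq> {0..1}"
begin

lemma iter_in: "x \<in> {0..1} \<Longrightarrow> (f ^^ n) x \<in> {0..1}"
proof (induction n)
  case (Suc n)
  then show ?case using maps by (auto simp: image_subset_iff)
qed auto

lemma cont_iter: "continuous_on {0..1} (f ^^ n)"
proof (induction n)
  case (Suc n)
  have "continuous_on ((f ^^ n) ` {0..1}) f"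
    using iter_in by (intro continuous_on_subset[OF cont]) blast
  then show ?case
    using continuous_on_compose[OF Suc] by simp
qed (simp add: id_def)

lemma iter_near:
  assumes "q \<in> {0..1}" "e > 0"
  obtains d where "d > 0" "\<And>x. x \<in> {0..1} \<Longrightarrow> dist x q < d \<Longrightarrow> dist ((f ^^ n) x) ((f ^^ n) q) < e"
  using cont_iter[of n] assms unfolding continuous_on_iff by metis

lemma tendsto_iter:
  assumes "X \<longlonglongrightarrow> z" "\<And>i. X i \<in> {0..1}"
  shows "z \<in> {0..1}" "(\<lambda>i. (f ^^ n) (X i)) \<longlonglongrightarrow> (f ^^ n) z"
proof -
  show z: "z \<in> {0..1}"
    by (rule closed_sequentially[of "{0..1}" X z]) (use assms in auto)
  show "(\<lambda>i. (f ^^ n) (X i)) \<longlonglongrightarrow> (f ^^ n) z"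
    by (rule continuous_on_tendsto_compose[OF cont_iter assms(1) z]) (use assms(2) in auto)
qed

lemma iter_connected_compact:
  assumes "J \<subseteq> {0..1}" "connected J" "compact J"
  shows "connected ((f ^^ n) ` J)" "compact ((f ^^ n) ` J)"
  using assms connected_continuous_image compact_continuous_image continuous_on_subset[OF cont_iter]
  by blast+

section \<open>Invariance of limit sets and their non-wandering points\<close>

lemma omega_limit_iter:
  assumes "x \<in> {0..1}" "z \<in> omega_limit f x"
  shows "(f ^^ n) z \<in> omega_limit f x"
proof -
  obtain r :: "nat \<Rightarrow> nat" where r: "strict_mono r" "(\<lambda>i. (f ^^ r i) x) \<longlonglongrightarrow> z"
    using assms(2) by (auto simp: omega_limit_def)
  have "(\<lambda>i. (f ^^ n) ((f ^^ r i) x)) \<longlonglongrightarrow> (f ^^ n) z"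
    using tendsto_iter[OF r(2)] iter_in assms(1) by blast
  then have "(\<lambda>i. (f ^^ (n + r i)) x) \<longlonglongrightarrow> (f ^^ n) z"
    by (simp add: funpow_add)
  moreover have "strict_mono (\<lambda>i. n + r i)"
    using r(1) by (auto simp: strict_mono_def)
  ultimately show ?thesis
    unfolding omega_limit_def by blast
qed

text \<open>The orbit visits \<open>U\<close> at two times \<open>i < j\<close>, so \<open>U\<close>
  returns to itself after \<open>j - i\<close> steps.\<close>

lemma omega_limit_subset_nonwandering:
  assumes "x \<in> {0..1}"
  shows "omega_limit f x \<subseteq> nonwandering_set f"
proof
  fix y
  assume y: "y \<in> omega_limit f x"
  then obtain r :: "nat \<Rightarrow> nat" where "(\<lambda>i. (f ^^ r i) x) \<longlonglongrightarrow> y"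
    by (auto simp: omega_limit_def)
  then have y01: "y \<in> {0..1}"
    using tendsto_iter(1) iter_in assms by blast
  show "y \<in> nonwandering_set f"
    unfolding nonwandering_set_def
  proof (intro CollectI conjI allI impI y01, elim conjE)
    fix U
    assume "openin (top_of_set {0..1}) U" "y \<in> U"
    then obtain e where e: "e > 0" "\<And>z. z \<in> {0..1} \<Longrightarrow> dist z y < e \<Longrightarrow> z \<in> U"
      unfolding openin_euclidean_subtopology_iff by blast
    obtain i where i: "dist ((f ^^ i) x) y < e"
      using y e(1) unfolding omega_limit_iff by blast
    obtain j where j: "j > i" "dist ((f ^^ j) x) y < e"
      using y e(1) unfolding omega_limit_iff by blast
    have "(f ^^ j) x = (f ^^ (j - i)) ((f ^^ i) x)"
      using j(1) by (simp flip: funpow_add comp_apply[of "f ^^ (j - i)"])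
    moreover have "(f ^^ i) x \<in> U" "(f ^^ j) x \<in> U"
      using e(2) i j(2) iter_in assms by auto
    ultimately show "\<exists>n>0. (f ^^ n) ` U \<inter> U \<noteq> {}"
      using j(1) by (intro exI[of _ "j - i"]) auto
  qed
qed

text \<open>By compactness, the orbit points \<open>n\<close> steps before the visits near
  \<open>y\<close> have a limit point \<open>z\<close>, and continuity gives
  \<open>(f ^^ n) z = y\<close>.\<close>

lemma omega_limit_subset_image:
  assumes x: "x \<in> {0..1}"
  shows "omega_limit f x \<subseteq> (f ^^ n) ` omega_limit f x"
proof
  fix y
  assume "y \<in> omega_limit f x"
  then obtain r :: "nat \<Rightarrow> nat" where r: "strict_mono r" "(\<lambda>i. (f ^^ r i) x) \<longlonglongrightarrow> y"
    by (auto simp: omega_limit_def)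
  \<comment> \<open>The shift to \<open>r (i + n)\<close>, which is at least \<open>n\<close>, keeps
    the subtraction from being truncated.\<close>
  define X where "X i = (f ^^ (r (i + n) - n)) x" for i
  have X01: "X i \<in> {0..1}" for i
    using iter_in x by (simp add: X_def del: atLeastAtMost_iff)
  have fX: "(f ^^ n) (X i) = (f ^^ r (i + n)) x" for i
  proof -
    have "n \<le> r (i + n)"
      using seq_suble[OF r(1), of "i + n"] by linarith
    then show ?thesis
      by (simp add: X_def flip: funpow_add comp_apply[of "f ^^ n"])
  qed
  obtain z s where s: "z \<in> {0..1}" "strict_mono (s :: nat \<Rightarrow> nat)" "(X \<circ> s) \<longlonglongrightarrow> z"
    using compact_Icc[of 0 "1::real"] X01 unfolding compact_def by metis
  have "(\<lambda>i. (f ^^ n) (X (s i))) \<longlonglongrightarrow> (f ^^ n) z"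
    using tendsto_iter(2)[OF s(3)] X01 by simp
  moreover have "(\<lambda>i. (f ^^ n) (X (s i))) \<longlonglongrightarrow> y"
    unfolding fX using LIMSEQ_subseq_LIMSEQ[OF LIMSEQ_ignore_initial_segment[OF r(2), of n] s(2)]
    by (simp add: comp_def)
  ultimately have "y = (f ^^ n) z"
    by (rule LIMSEQ_unique[symmetric])
  moreover have "z \<in> omega_limit f x"
  proof -
    have "strict_mono (\<lambda>i. r (s i + n) - n)"
    proof (rule strict_monoI)
      fix i j :: nat
      assume "i < j"
      then have "r (s i + n) < r (s j + n)"
        using s(2) r(1) by (simp add: strict_mono_less)
      moreover have "n \<le> r (s i + n)"
        using seq_suble[OF r(1), of "s i + n"] by linarith
      ultimately show "r (s i + n) - n < r (s j + n) - n"
        by linarith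
    qed
    then show ?thesis
      using s(3) unfolding omega_limit_def comp_def X_def by blast
  qed
  ultimately show "y \<in> (f ^^ n) ` omega_limit f x"
    by blast
qed

section \<open>A recurrent orbit from expanding one-sided segments\<close>

text \<open>The sign of \<open>s\<close> selects a side of \<open>y\<close>, here and below.\<close>
lemma omega_set_if_segments_expand:
  assumes y: "y \<in> {0..1}" and u0: "u0 \<in> {0..1}" "0 < s * (u0 - y)"
    and step: "\<And>u. u \<in> {0..1} \<Longrightarrow> 0 < s * (u - y) \<Longrightarrow>
      \<exists>l>0. \<exists>v\<in>{0..1}. 0 < s * (v - y) \<and> closed_segment y v \<subseteq> (f ^^ l) ` closed_segment y u"
  shows "y \<in> omega_set f"
proof -
  have "\<exists>U. \<forall>k. (U k \<in> {0..1} \<and> 0 < s * (U k - y) \<and> dist (U k) y \<le> 1 / real (Suc k)) \<and>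
      (\<exists>l>0. closed_segment y (U (Suc k)) \<subseteq> (f ^^ l) ` closed_segment y (U k))"
  proof (rule dependent_nat_choice)
    show "\<exists>u. u \<in> {0..1} \<and> 0 < s * (u - y) \<and> dist u y \<le> 1 / real (Suc 0)"
      using u0 y by (intro exI[of _ u0]) (auto simp: dist_real_def)
  next
    fix u k
    assume "u \<in> {0..1} \<and> 0 < s * (u - y) \<and> dist u y \<le> 1 / real (Suc k)"
    then obtain l v where lv: "l > 0" "v \<in> {0..1}" "0 < s * (v - y)"
      "closed_segment y v \<subseteq> (f ^^ l) ` closed_segment y u"
      using step by meson
    \<comment> \<open>Since \<open>v\<close> is within 1 of \<open>y\<close>, contracting towards
      \<open>y\<close> by \<open>t\<close> gives the required distance and stays on the same
      side.\<close>
    define t where "t = 1 / real (Suc (Suc k))"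
    define w where "w = (1 - t) *\<^sub>R y + t *\<^sub>R v"
    have t: "0 < t" "t \<le> 1"
      by (auto simp: t_def)
    have wy: "w - y = t * (v - y)"
      by (simp add: w_def algebra_simps)
    have w: "w \<in> closed_segment y v"
      using t unfolding w_def closed_segment_def by auto
    then have "w \<in> {0..1}" "closed_segment y w \<subseteq> closed_segment y v"
      using closed_segment_subset[of y "{0..1}" v] y lv(2) by (auto simp: subset_closed_segment)
    moreover have "s * (w - y) = t * (s * (v - y))"
      by (simp add: wy)
    then have "0 < s * (w - y)"
      using mult_pos_pos[OF t(1) lv(3)] by argo
    moreover have "\<bar>w - y\<bar> \<le> t"
    proof -
      have "\<bar>v - y\<bar> \<le> 1"
        using lv(2) y by (auto simp: abs_le_iff)
      then show ?thesis
        using mult_left_mono[of "\<bar>v - y\<bar>" 1 t] t by (simp add: wy abs_mult)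
    qed
    ultimately show "\<exists>w. (w \<in> {0..1} \<and> 0 < s * (w - y) \<and> dist w y \<le> 1 / real (Suc (Suc k))) \<and>
        (\<exists>l>0. closed_segment y w \<subseteq> (f ^^ l) ` closed_segment y u)"
      using lv(1,4) unfolding t_def dist_real_def by blast
  qed
  then obtain U l where U: "\<And>k. U k \<in> {0..1}" "\<And>k. dist (U k) y \<le> 1 / real (Suc k)"
    and l: "\<And>k. l k > 0" "\<And>k. closed_segment y (U (Suc k)) \<subseteq> (f ^^ l k) ` closed_segment y (U k)"
    by metis
  define t where "t k = (\<Sum>i<k. l i)" for k
  \<comment> \<open>Points visiting the first segments at the prescribed times; a point of all these
    nested compact sets makes every visit.\<close>
  define K where "K k = (\<Inter>i\<le>k. {0..1} \<inter> (f ^^ t i) -` closed_segment y (U i))" for k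
  \<comment> \<open>Mere nonemptiness would not pass through the induction: each point of the next
    segment must be pulled back into \<open>K k\<close>.\<close>
  have onto: "closed_segment y (U k) \<subseteq> (f ^^ t k) ` K k" for k
  proof (induction k)
    case 0
    have "closed_segment y (U 0) \<subseteq> {0..1}"
      by (rule closed_segment_subset) (use y U in auto)
    then show ?case
      by (auto simp: K_def t_def)
  next
    case (Suc k)
    show ?case
    proof
      fix v
      assume v: "v \<in> closed_segment y (U (Suc k))"
      then obtain x where x: "x \<in> K k" "v = (f ^^ l k) ((f ^^ t k) x)"
        using l(2)[of k] Suc by blast
      have "v = (f ^^ t (Suc k)) x"
        by (simp add: x(2) t_def add.commute[of _ "l k"] funpow_add)
      moreover from this have "x \<in> K (Suc k)"
        using v x(1) by (auto simp: K_def atMost_Suc)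
      ultimately show "v \<in> (f ^^ t (Suc k)) ` K (Suc k)"
        by blast
    qed
  qed
  have "(\<Inter>k. K k) \<noteq> {}"
  proof (rule compact_nest)
    fix k
    have "closed (K k)"
      unfolding K_def by (intro closed_INT ballI continuous_closed_preimage cont_iter) auto
    moreover have "K k \<subseteq> {0..1}"
      by (auto simp: K_def)
    ultimately show "compact (K k)"
      using compact_Icc compact_Int_closed by (metis inf.absorb_iff2 inf_commute)
    show "K k \<noteq> {}"
      using onto[of k] by auto
  next
    show "K n \<subseteq> K m" if "m \<le> n" for m n
      using that by (auto simp: K_def)
  qed
  then obtain x where x: "\<And>k. x \<in> K k"
    by blast
  have "dist ((f ^^ t k) x) y \<le> 1 / real (Suc k)" for k
  proof -
    have "(f ^^ t k) x \<in> closed_segment y (U k)"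
      using x[of k] by (auto simp: K_def)
    then show ?thesis
      using U(2)[of k] by (auto simp: closed_segment_eq_real_ivl dist_real_def split: if_splits)
  qed
  then have "(\<lambda>k. (f ^^ t k) x) \<longlonglongrightarrow> y"
    by (intro LIMSEQ_if_dist_le_inverse)
  moreover have "strict_mono t"
    using l(1) by (simp add: strict_mono_Suc_iff t_def)
  ultimately have "y \<in> omega_limit f x"
    unfolding omega_limit_def by blast
  moreover have "x \<in> {0..1}"
    using x[of 0] by (simp add: K_def)
  ultimately show ?thesis
    by (auto simp: omega_set_def)
qed

section \<open>Expansion of one-sided segments\<close>

text \<open>The hypothesis \<open>returns\<close> serves twice: it brings late images of the segment
  close to \<open>q n\<close>, and at the end it supplies the witness
  \<open>v = (f ^^ n) x\<close>.\<close>

lemma segment_expands: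
  fixes q :: "nat \<Rightarrow> real"
  assumes y: "y \<in> {0..1}" "y \<notin> omega_limit f y"
    and q: "\<And>n. q n \<in> {0..1}" "\<And>n. (f ^^ n) (q n) = y"
    and S: "infinite S"
    and returns: "\<And>n e N. n \<in> S \<Longrightarrow> e > 0 \<Longrightarrow> \<exists>x\<in>{0..1}. \<exists>m>N. dist x (q n) < e \<and>
      dist ((f ^^ m) x) (q n) < e \<and> 0 < s * ((f ^^ n) x - y)"
    and u: "u \<in> {0..1}" "0 < s * (u - y)"
  shows "\<exists>l>0. \<exists>v\<in>{0..1}. 0 < s * (v - y) \<and> closed_segment y v \<subseteq> (f ^^ l) ` closed_segment y u"
proof -
  define J where "J = closed_segment y u"
  have J: "J \<subseteq> {0..1}" "connected J" "compact J" "y \<in> J"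
    using closed_segment_subset[of y "{0..1}" u] y(1) u(1) by (auto simp: J_def)
  note imJ = iter_connected_compact[OF J(1-3)]
  have "u \<noteq> y"
    using u(2) by auto

  have near: "\<exists>z\<in>J. \<exists>m>N. dist ((f ^^ m) z) (q n) < e" if n: "n \<in> S" and e: "e > 0" for n e N
  proof -
    obtain d where d: "d > 0"
      "\<And>x. x \<in> {0..1} \<Longrightarrow> dist x (q n) < d \<Longrightarrow> dist ((f ^^ n) x) y < \<bar>u - y\<bar>"
      using iter_near[OF q(1)[of n], of "\<bar>u - y\<bar>" n] \<open>u \<noteq> y\<close> q(2) by auto
    \<comment> \<open>The first \<open>n\<close> steps bring \<open>x\<close> into \<open>J\<close>;
      asking for \<open>m > N + n\<close> leaves more than \<open>N\<close> steps from
      there.\<close>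
    obtain x m where x: "x \<in> {0..1}" "m > N + n" "dist x (q n) < min d e"
      "dist ((f ^^ m) x) (q n) < min d e" "0 < s * ((f ^^ n) x - y)"
      using returns[OF n, of "min d e" "N + n"] d(1) e by auto
    have "(f ^^ n) x \<in> J"
      unfolding J_def closed_segment_real_mem_iff[OF x(5) u(2)]
      using d(2)[OF x(1)] x(3) by (simp add: dist_real_def)
    moreover have "(f ^^ (m - n)) ((f ^^ n) x) = (f ^^ m) x"
      using x(2) by (simp flip: funpow_add comp_apply[of "f ^^ (m - n)"])
    ultimately show ?thesis
      using x(2,4) by (intro bexI[of _ "(f ^^ n) x"] exI[of _ "m - n"]) auto
  qed

  have "inj q"
  proof (rule linorder_injI)
    fix m n :: nat
    assume mn: "m < n"
    show "q m \<noteq> q n"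
    proof
      assume "q m = q n"
      then have "(f ^^ (n - m)) y = (f ^^ (n - m)) ((f ^^ m) (q n))"
        using q(2)[of m] by simp
      also have "\<dots> = (f ^^ n) (q n)"
        using mn by (simp flip: funpow_add comp_apply[of "f ^^ (n - m)"])
      finally show False
        using periodic_in_omega_limit[of "n - m" f y] mn y(2) q(2) by simp
    qed
  qed

  obtain d N where d: "d > 0" "\<And>i. i > N \<Longrightarrow> dist ((f ^^ i) y) y \<ge> d"
    using y(2) unfolding omega_limit_iff by (meson not_le)
  \<comment> \<open>\<open>(f ^^ m) ` J\<close> contains \<open>(f ^^ m) y\<close>, at distance at least \<open>d\<close> from \<open>y\<close>; if it also meets
    the \<open>d / 2\<close>-ball around \<open>y\<close>, it contains \<open>y + d / 2\<close> or \<open>y - d / 2\<close>.\<close>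
  define A where "A c = {m. m > N \<and> c \<in> (f ^^ m) ` J}" for c
  have "\<exists>m>k. m \<in> A (y + d / 2) \<union> A (y - d / 2)" for k
  proof -
    \<comment> \<open>One \<open>n\<close> suffices here: \<open>f ^^ n\<close> carries a point
      close to \<open>q n\<close> to a point close to \<open>y\<close>.\<close>
    obtain n where n: "n \<in> S"
      using infinite_imp_nonempty[OF S] by blast
    obtain e where e: "e > 0" "\<And>x. x \<in> {0..1} \<Longrightarrow> dist x (q n) < e \<Longrightarrow> dist ((f ^^ n) x) y < d / 2"
      using iter_near[OF q(1)[of n], of "d / 2" n] d(1) q(2) by auto
    obtain z m where z: "z \<in> J" "m > N + k" "dist ((f ^^ m) z) (q n) < e"
      using near[OF n e(1)] by blast
    have "dist ((f ^^ (n + m)) z) y < d / 2"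
      using e(2)[OF iter_in z(3)] z(1) J(1) by (auto simp: funpow_add)
    moreover have "dist ((f ^^ (n + m)) y) y \<ge> d"
      using d(2) z(2) by simp
    moreover have "closed_segment ((f ^^ (n + m)) y) ((f ^^ (n + m)) z) \<subseteq> (f ^^ (n + m)) ` J"
      by (intro closed_segment_subset_connected_real imJ imageI z(1) J(4))
    ultimately have "y + d / 2 \<in> (f ^^ (n + m)) ` J \<or> y - d / 2 \<in> (f ^^ (n + m)) ` J"
      by (auto simp: closed_segment_eq_real_ivl dist_real_def subset_iff abs_if split: if_splits)
    then show ?thesis
      using z(2) by (intro exI[of _ "n + m"]) (auto simp: A_def)
  qed
  then have "infinite (A (y + d / 2) \<union> A (y - d / 2))"
    unfolding infinite_nat_iff_unbounded by blast
  then obtain c where c: "infinite (A c)"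
    unfolding finite_Un by blast
  then obtain m where m: "m \<in> A c"
    using infinite_imp_nonempty by blast
  obtain m' where m': "m' \<in> A c" "m' > m"
    using c unfolding infinite_nat_iff_unbounded by blast

  \<comment> \<open>Both images contain \<open>c\<close>, so their union is connected.\<close>
  define B where "B = (f ^^ m) ` J \<union> (f ^^ m') ` J"
  have "connected B"
    unfolding B_def using m m'(1) by (intro connected_Un imJ) (auto simp: A_def)
  have B01: "B \<subseteq> {0..1}"
    using J(1) iter_in by (auto simp: B_def simp del: atLeastAtMost_iff)
  \<comment> \<open>\<open>f ^^ M\<close> maps the point \<open>(f ^^ m) y\<close> of \<open>B\<close> to \<open>(f ^^ m') y\<close>, again in \<open>B\<close>, so the orbit of \<open>B\<close>
    consists of the \<open>M\<close> connected sets \<open>F i\<close> below.\<close>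
  define M where "M = m' - m"
  have "M > 0"
    using m'(2) by (simp add: M_def)
  define C where "C i j = (f ^^ (i + M * j)) ` B" for i j
  have C_conn: "connected (C i j)" for i j
    unfolding C_def using \<open>connected B\<close> B01 cont_iter
    by (blast intro: connected_continuous_image continuous_on_subset)
  have C_meet: "C i j \<inter> C i (Suc j) \<noteq> {}" for i j
  proof -
    have "i + M * Suc j = (i + M * j) + M"
      by simp
    then have "(f ^^ (i + M * Suc j)) ((f ^^ m) y) = (f ^^ (i + M * j)) ((f ^^ M) ((f ^^ m) y))"
      by (simp only: funpow_add comp_apply)
    then have "(f ^^ (i + M * j)) ((f ^^ M) ((f ^^ m) y)) \<in> C i (Suc j)"
      unfolding C_def B_def using J(4) by (metis UnI1 imageI)
    moreover have "(f ^^ M) ((f ^^ m) y) = (f ^^ m') y"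
      using m'(2) by (simp add: M_def flip: funpow_add comp_apply[of "f ^^ (m' - m)"])
    then have "(f ^^ (i + M * j)) ((f ^^ M) ((f ^^ m) y)) \<in> C i j"
      unfolding C_def B_def using J(4) by auto
    ultimately show ?thesis
      by blast
  qed
  define F where "F i = (\<Union>j. C i j)" for i
  \<comment> \<open>Images of \<open>J\<close> from time \<open>m\<close> on are covered by the sets
    \<open>F i\<close>: division by \<open>M\<close> splits the excess time \<open>h\<close> into
    \<open>i\<close> and \<open>j\<close>.\<close>
  have "q n \<in> closure (\<Union>i<M. F i)" if n: "n \<in> S" for n
    unfolding closure_approachable
  proof (intro allI impI)
    fix e :: real
    assume "e > 0"
    then obtain z k where z: "z \<in> J" "k > m" "dist ((f ^^ k) z) (q n) < e"
      using near[OF n] by blast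
    define h where "h = k - m"
    have "(f ^^ k) z = (f ^^ h) ((f ^^ m) z)"
      using z(2) by (simp add: h_def flip: funpow_add comp_apply[of "f ^^ (k - m)"])
    moreover have "(f ^^ m) z \<in> B"
      using z(1) by (simp add: B_def)
    ultimately have "(f ^^ k) z \<in> C (h mod M) (h div M)"
      by (simp add: C_def)
    then show "\<exists>w\<in>\<Union>i<M. F i. dist w (q n) < e"
      using z(3) \<open>M > 0\<close> by (auto simp: F_def intro!: bexI[of _ "h mod M"])
  qed
  moreover have "closure (\<Union>i<M. F i) \<subseteq> (\<Union>i<M. closure (F i))"
    using closure_subset by (intro closure_minimal closed_UN) fastforce+
  ultimately have "\<forall>n\<in>S. \<exists>i\<in>{..<M}. q n \<in> closure (F i)"
    by blast
  then obtain i where i: "infinite {n \<in> S. q n \<in> closure (F i)}"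
    using pigeonhole_infinite_rel[OF S, of "{..<M}" "\<lambda>n i. q n \<in> closure (F i)"] by auto
  then have "infinite (q ` {n \<in> S. q n \<in> closure (F i)})"
    using \<open>inj q\<close> by (metis finite_imageD inj_on_subset subset_UNIV)
  \<comment> \<open>Only two of these infinitely many values can be endpoints; any other lies
    strictly between two points of \<open>F i\<close>.\<close>
  then have "\<not> q ` {n \<in> S. q n \<in> closure (F i)} \<subseteq> {Inf (F i), Sup (F i)}"
    by (meson finite.emptyI finite.insertI finite_subset)
  then obtain n where n: "n \<in> S" "q n \<in> closure (F i)" "q n \<noteq> Inf (F i)" "q n \<noteq> Sup (F i)"
    by blast
  have F01: "F i \<subseteq> {0..1}"
    using B01 iter_in by (auto simp: F_def C_def simp del: atLeastAtMost_iff)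
  then have bdd: "bdd_below (F i)" "bdd_above (F i)"
    by (meson bdd_below_Icc bdd_below_mono bdd_above_Icc bdd_above_mono)+
  have ne: "F i \<noteq> {}"
    using n(2) by auto
  have "closure (F i) \<subseteq> {Inf (F i)..Sup (F i)}"
    using bdd by (intro closure_minimal) (auto intro: cInf_lower cSup_upper)
  then have "Inf (F i) < q n" "q n < Sup (F i)"
    using n by force+
  then obtain a b where ab: "a \<in> F i" "a < q n" "b \<in> F i" "q n < b"
    using cInf_less_iff[OF ne bdd(1)] less_cSup_iff[OF ne bdd(2)] by blast
  then obtain ja jb where "a \<in> C i ja" "b \<in> C i jb"
    by (auto simp: F_def)
  \<comment> \<open>Finitely many links of the chain already join \<open>a\<close> to
    \<open>b\<close>; finiteness is what makes \<open>Z\<close> below closed.\<close>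
  define G where "G = (\<Union>j\<le>max ja jb. C i j)"
  have "connected G"
    unfolding G_def using C_conn C_meet by (rule connected_chain)
  moreover have "a \<in> G" "b \<in> G"
    using \<open>a \<in> C i ja\<close> \<open>b \<in> C i jb\<close> by (auto simp: G_def intro: bexI[of _ ja] bexI[of _ jb])
  ultimately have abG: "{a..b} \<subseteq> G"
    by (rule connected_contains_Icc)

  define L where "L = (\<Union>j\<le>max ja jb. {i + M * j + m, i + M * j + m'})"
  have "finite L"
    by (auto simp: L_def)
  have GL: "G \<subseteq> (\<Union>l\<in>L. (f ^^ l) ` J)"
    unfolding G_def C_def B_def L_def by (fastforce simp: funpow_add)
  \<comment> \<open>Near \<open>q n\<close>, every point of \<open>G\<close> lies in an image of \<open>J\<close> that also contains \<open>q n\<close>.\<close>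
  define Z where "Z = (\<Union>l\<in>{l \<in> L. q n \<notin> (f ^^ l) ` J}. (f ^^ l) ` J)"
  have "closed Z"
    unfolding Z_def using \<open>finite L\<close> imJ by (intro closed_UN) (auto intro: compact_imp_closed)
  then have "open ({a<..<b} - Z)"
    by (intro open_Diff) auto
  moreover have "q n \<in> {a<..<b} - Z"
    using ab by (auto simp: Z_def)
  ultimately obtain e where e: "e > 0" "ball (q n) e \<subseteq> {a<..<b} - Z"
    unfolding open_contains_ball by blast
  obtain x where x: "x \<in> {0..1}" "dist x (q n) < e" "0 < s * ((f ^^ n) x - y)"
    using returns[OF n(1) e(1)] by blast
  have xe: "x \<in> {a<..<b} - Z"
    using e(2) x(2) by (auto simp: dist_commute subset_iff)
  then have "x \<in> G"
    using abG by auto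
  then obtain l where l: "l \<in> L" "x \<in> (f ^^ l) ` J"
    using GL by blast
  have ql: "q n \<in> (f ^^ l) ` J"
    using xe l by (auto simp: Z_def)
  \<comment> \<open>Members of \<open>A c\<close> exceed \<open>N\<close>, so the total time
    \<open>n + l\<close> is positive even when \<open>n = 0\<close>.\<close>
  have "l > 0"
    using l(1) m m'(1) by (auto simp: L_def A_def)
  have "y \<in> (f ^^ (n + l)) ` J" "(f ^^ n) x \<in> (f ^^ (n + l)) ` J"
    using imageI[OF ql, of "f ^^ n"] imageI[OF l(2), of "f ^^ n"] q(2)[of n]
    by (simp_all add: funpow_add image_comp)
  then have "closed_segment y ((f ^^ n) x) \<subseteq> (f ^^ (n + l)) ` J"
    by (intro closed_segment_subset_connected_real imJ)
  then show ?thesis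
    using x(3) iter_in[OF x(1), of n] \<open>l > 0\<close> unfolding J_def
    by (intro exI[of _ "n + l"] conjI bexI[of _ "(f ^^ n) x"]) auto
qed

section \<open>Late returns near non-wandering preimages\<close>

text \<open>Since \<open>q\<close> is not periodic, a small neighbourhood has no early returns. A
  point sent exactly to \<open>y\<close> cannot return late, because the orbit of \<open>y\<close>
  stays away from \<open>q\<close>.\<close>

lemma nonwandering_returns:
  assumes q: "q \<in> nonwandering_set f" and y: "(f ^^ n) q = y" "y \<notin> omega_limit f y" and e: "e > 0"
  shows "\<exists>x\<in>{0..1}. \<exists>m>N. dist x q < e \<and> dist ((f ^^ m) x) q < e \<and> (f ^^ n) x \<noteq> y"
proof -
  have q01: "q \<in> {0..1}"
    using q by (simp add: nonwandering_set_def)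
  then have y01: "y \<in> {0..1}"
    using iter_in y(1) by blast
  have "q \<notin> omega_limit f y"
    using omega_limit_iter[OF y01, of q n] y by auto
  then obtain d N' where d: "d > 0" "\<And>i. i > N' \<Longrightarrow> dist ((f ^^ i) y) q \<ge> d"
    unfolding omega_limit_iff by (meson not_le)
  \<comment> \<open>A time \<open>m > K\<close> exceeds \<open>N\<close> and leaves
    \<open>m - n > N'\<close>, the range where the bound \<open>d\<close> applies.\<close>
  define K where "K = N + N' + n"
  have "\<exists>r>0. \<forall>x\<in>{0..1}. dist x q < r \<longrightarrow> dist ((f ^^ m) x) q \<ge> r" if "m > 0" for m
  proof -
    have "(f ^^ m) q \<noteq> q"
    proof
      assume "(f ^^ m) q = q"
      then have "(f ^^ m) y = y"
        using y(1) by (metis add.commute comp_apply funpow_add)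
      then show False
        using periodic_in_omega_limit[OF that] y(2) by blast
    qed
    then have pos: "dist ((f ^^ m) q) q / 2 > 0"
      by simp
    obtain r where r: "r > 0"
      "\<And>x. x \<in> {0..1} \<Longrightarrow> dist x q < r \<Longrightarrow> dist ((f ^^ m) x) ((f ^^ m) q) < dist ((f ^^ m) q) q / 2"
      using iter_near[OF q01 pos, of m] by blast
    show ?thesis
    proof (intro exI[of _ "min r (dist ((f ^^ m) q) q / 2)"] conjI ballI impI)
      fix x :: real
      assume "x \<in> {0..1}" "dist x q < min r (dist ((f ^^ m) q) q / 2)"
      then have "dist ((f ^^ m) x) ((f ^^ m) q) < dist ((f ^^ m) q) q / 2"
        using r(2) by simp
      then show "min r (dist ((f ^^ m) q) q / 2) \<le> dist ((f ^^ m) x) q"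
        using dist_triangle2[of "(f ^^ m) q" q "(f ^^ m) x"] by (simp add: dist_commute)
    qed (use r(1) pos in simp)
  qed
  then obtain r where r: "\<And>m. m > 0 \<Longrightarrow> r m > 0"
    "\<And>m x. m > 0 \<Longrightarrow> x \<in> {0..1} \<Longrightarrow> dist x q < r m \<Longrightarrow> dist ((f ^^ m) x) q \<ge> r m"
    by metis
  \<comment> \<open>Only the finitely many times up to \<open>K\<close> must be excluded, so the
    minimum is positive.\<close>
  define R where "R = Min (insert e (insert d (r ` {1..K})))"
  have R: "R > 0" "R \<le> e" "R \<le> d" "\<And>m. 0 < m \<Longrightarrow> m \<le> K \<Longrightarrow> R \<le> r m"
  proof -
    show "R > 0"
      using e d(1) r(1) by (simp add: R_def)
    show "R \<le> e" "R \<le> d"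
      unfolding R_def by (intro Min_le; simp)+
    show "R \<le> r m" if "0 < m" "m \<le> K" for m
      unfolding R_def using that by (intro Min_le) auto
  qed
  define U where "U = {x \<in> {0..1}. dist x q < R}"
  have "U = {0..1} \<inter> ball q R"
    by (auto simp: U_def dist_commute)
  then have "openin (top_of_set {0..1}) U"
    by (simp add: openin_open_Int)
  moreover have "q \<in> U"
    using q01 R(1) by (simp add: U_def)
  ultimately obtain m where m: "m > 0" "(f ^^ m) ` U \<inter> U \<noteq> {}"
    using q unfolding nonwandering_set_def by blast
  then obtain x where x: "x \<in> {0..1}" "dist x q < R" "dist ((f ^^ m) x) q < R"
    by (auto simp: U_def)
  have "m > K"
  proof (rule ccontr)
    assume "\<not> m > K"
    then show False
      using r(2)[OF m(1) x(1)] R(4)[OF m(1)] x(2,3) by linarith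
  qed
  moreover have "(f ^^ n) x \<noteq> y"
  proof
    assume "(f ^^ n) x = y"
    then have "(f ^^ (m - n)) y = (f ^^ m) x"
      using \<open>m > K\<close> by (auto simp: K_def simp flip: funpow_add comp_apply[of "f ^^ (m - n)"])
    moreover have "m - n > N'"
      using \<open>m > K\<close> unfolding K_def by linarith
    ultimately show False
      using d(2)[of "m - n"] x(3) R(3) by simp
  qed
  ultimately show ?thesis
    using x R(2) by (intro bexI[of _ x] exI[of _ m]) (auto simp: K_def)
qed

section \<open>The two inclusions\<close>

lemma omega_set_eq: "omega_set f = (\<Inter>n. (f ^^ n) ` nonwandering_set f)"
proof
  show "omega_set f \<subseteq> (\<Inter>n. (f ^^ n) ` nonwandering_set f)"
    unfolding omega_set_def
  proof (intro UN_least INT_greatest)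
    fix x :: real and n
    assume x: "x \<in> {0..1}"
    show "omega_limit f x \<subseteq> (f ^^ n) ` nonwandering_set f"
      by (rule order_trans[OF omega_limit_subset_image[OF x] image_mono[OF omega_limit_subset_nonwandering[OF x]]])
  qed
next
  show "(\<Inter>n. (f ^^ n) ` nonwandering_set f) \<subseteq> omega_set f"
  proof
    fix y
    assume y: "y \<in> (\<Inter>n. (f ^^ n) ` nonwandering_set f)"
    have "\<exists>x. x \<in> nonwandering_set f \<and> (f ^^ n) x = y" for n
      using INT_D[OF y, of n] by (auto simp: image_iff)
    then obtain q where q: "\<And>n. q n \<in> nonwandering_set f" "\<And>n. (f ^^ n) (q n) = y"
      by metis
    have q01: "q n \<in> {0..1}" for n
      using q(1)[of n] by (simp add: nonwandering_set_def)
    have y01: "y \<in> {0..1}"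
      using q01[of 0] q(2)[of 0] by simp
    show "y \<in> omega_set f"
    proof (cases "y \<in> omega_limit f y")
      case True
      then show ?thesis
        using y01 by (auto simp: omega_set_def)
    next
      case False
      define R where "R s n e N \<longleftrightarrow> (\<exists>x\<in>{0..1}. \<exists>m>N. dist x (q n) < e \<and>
        dist ((f ^^ m) x) (q n) < e \<and> 0 < s * ((f ^^ n) x - y))" for s e :: real and n N
      define P where "P s n \<longleftrightarrow> (\<forall>e>0. \<forall>N. R s n e N)" for s n
      \<comment> \<open>If both sides failed, one return with the smaller radius and the larger time
        bound would contradict one of the failures.\<close>
      have "P 1 n \<or> P (-1) n" for n
      proof (rule ccontr)
        assume "\<not> (P 1 n \<or> P (-1) n)"
        then obtain e N e' N' where neg: "e > 0" "\<not> R 1 n e N" "e' > 0" "\<not> R (-1) n e' N'"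
          unfolding P_def by blast
        obtain x m where x: "x \<in> {0..1}" "m > max N N'" "dist x (q n) < min e e'"
          "dist ((f ^^ m) x) (q n) < min e e'" "(f ^^ n) x \<noteq> y"
          using nonwandering_returns[OF q(1) q(2) False, of "min e e'" "max N N'" n] neg(1,3) by auto
        have "R 1 n e N" if "(f ^^ n) x > y"
          unfolding R_def using x that by (intro bexI[of _ x] exI[of _ m]) auto
        moreover have "R (-1) n e' N'" if "(f ^^ n) x < y"
          unfolding R_def using x that by (intro bexI[of _ x] exI[of _ m]) auto
        ultimately show False
          using neg(2,4) x(5) by linarith
      qed
      \<comment> \<open>One side must serve infinitely many \<open>n\<close>; it stays fixed
        throughout the iteration.\<close>
      then have "UNIV = {n. P 1 n} \<union> {n. P (-1) n}"
        by blast
      then obtain s where s: "infinite {n. P s n}"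
        by (metis finite_Un infinite_UNIV_nat)
      have ret: "\<exists>x\<in>{0..1}. \<exists>m>N. dist x (q n) < e \<and> dist ((f ^^ m) x) (q n) < e \<and>
          0 < s * ((f ^^ n) x - y)" if "n \<in> {n. P s n}" "e > 0" for n e N
        using that unfolding P_def R_def by blast
      \<comment> \<open>Any such return provides the endpoint of an initial segment on the chosen
        side.\<close>
      obtain n where "n \<in> {n. P s n}"
        using infinite_imp_nonempty[OF s] by blast
      then obtain x where "x \<in> {0..1}" "0 < s * ((f ^^ n) x - y)"
        using ret[of n 1 0] zero_less_one by blast
      then show ?thesis
        using segment_expands[OF y01 False q01 q(2) s ret]
        by (intro omega_set_if_segments_expand[OF y01 iter_in])
    qed
  qed
qed

end

theorem theorem7p5:
  fixes f :: "real \<Rightarrow> real"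
  assumes "continuous_on {0..1} f"
    and "f ` {0..1} \<subseteq> {0..1}"
  shows "omega_set f = (\<Inter>n. (f ^^ n) ` nonwandering_set f)"
  using assms by (intro interval_map.omega_set_eq interval_map.intro)

end
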